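(* Let $F_1:\mathbb{R}^n\to2^{\mathbb{R}^{m_1}}$ and $F_2:\mathbb{R}^n\to2^{\mathbb{R}^{m_2}}$ be set-valued mappings such that $\operatorname{graph}(F_1,F_2)$ is a $P$-set in $\mathbb{R}^{n+m_1+m_2}$. Let $L:\mathbb{R}^{m_1}\times\mathbb{R}^{m_2}\to\mathbb{R}^k$ be a linear surjection. Then for any continuous selection $f(x)\in L(F_1(x),F_2(x))$, $x\in\operatorname{dom}(F_1,F_2)$, there exist continuous selections $f_i(x)\in F_i(x)$, $i=1,2$, with $f(x)=L(f_1(x),f_2(x))$ for all $x\in\operatorname{dom}(F_1,F_2)$.
   Context: $(F_1,F_2)$ denotes the set-valued mapping $x\mapsto F_1(x)\times F_2(x)$, $\operatorname{dom}(F_1,F_2)=\{x\in\mathbb{R}^n:F_1(x)\neq\emptyset,\ F_2(x)\ne\emptyset\}$, $\operatorname{graph}(F_1,F_2)=\{(x,y_1,y_2): x\in\mathbb{R}^n,\ y_1\in F_1(x),\ y_2\in F_2(x)\}$, and $L(F_1(x),F_2(x))=\{L(y_1,y_2): y_1\in F_1(x),\ y_2\in F_2(x)\}$. A continuous selection of a set-valued mapping is a continuous single-valued function whose value at each point of the domain belongs to the image set at that point. $P$-sets: for a unit vector $q\in\mathbb{R}^N$ let $L(q)=\{z\in\mathbb{R}^N:\langle q,z\rangle=0\}$; each $z\in\mathbb{R}^N$ is written $z=x+\mu q=(x,\mu)$ with $x\in L(q)$, $\mu\in\mathbb{R}$, and $P_q z=x$ is the orthogonal projection onto $L(q)$. For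 a convex compact $A\subset\mathbb{R}^N$ define $f_{A,q}:P_qA\to\mathbb{R}$ by $f_{A,q}(x)=\min\{\mu : (x,\mu)\in A\}$. A convex compact set $A\subset\mathbb{R}^N$ is called a $P$-set if for every unit vector $q$ the function $f_{A,q}$ is continuous on $P_qA$. *)

theory Defs
  imports "HOL-Analysis.Analysis"
begin

definition orth_proj :: "'a::euclidean_space \<Rightarrow> 'a \<Rightarrow> 'a" where
  "orth_proj q z = z - (q \<bullet> z) *\<^sub>R q"

text \<open>For compact \<open>A\<close> and \<open>x \<in> orth_proj q ` A\<close> (\<open>q\<close> a unit vector) the minimum below is
  attained; elsewhere the value is irrelevant.\<close>

definition lower_fun :: "'a::euclidean_space set \<Rightarrow> 'a \<Rightarrow> 'a \<Rightarrow> real" where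
  "lower_fun A q x = (LEAST \<mu>. x + \<mu> *\<^sub>R q \<in> A)"

definition P_set :: "'a::euclidean_space set \<Rightarrow> bool" where
  "P_set A \<longleftrightarrow> convex A \<and> compact A \<and>
     (\<forall>q. norm q = 1 \<longrightarrow> continuous_on (orth_proj q ` A) (lower_fun A q))"

definition pair_dom :: "('a \<Rightarrow> 'b set) \<Rightarrow> ('a \<Rightarrow> 'c set) \<Rightarrow> 'a set" where
  "pair_dom F1 F2 = {x. F1 x \<noteq> {} \<and> F2 x \<noteq> {}}"

definition pair_graph :: "('a \<Rightarrow> 'b set) \<Rightarrow> ('a \<Rightarrow> 'c set) \<Rightarrow> ('a \<times> 'b \<times> 'c) set" where
  "pair_graph F1 F2 = {(x, y1, y2). y1 \<in> F1 x \<and> y2 \<in> F2 x}"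

text \<open>The domain \<open>D\<close> is explicit, since selections of \<open>F1\<close> and \<open>F2\<close> are taken on the common
  domain \<open>pair_dom F1 F2\<close>, which may be smaller than the set where a single \<open>F1 x\<close> is nonempty.\<close>

definition continuous_selection ::
    "'a::topological_space set \<Rightarrow> ('a \<Rightarrow> 'b::topological_space set) \<Rightarrow> ('a \<Rightarrow> 'b) \<Rightarrow> bool" where
  "continuous_selection D F f \<longleftrightarrow> continuous_on D f \<and> (\<forall>x\<in>D. f x \<in> F x)"

end

theory Submission
  imports Defs
begin

text \<open>
  Write \<open>A\<close> for the graph of \<open>(F1, F2)\<close> and \<open>T\<close> for the linear map sending \<open>(x, y)\<close> to
  \<open>(x, L y)\<close>. Choosing \<open>f1 x\<close> and \<open>f2 x\<close> with \<open>L (f1 x, f2 x) = f x\<close> means choosing a point of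
  \<open>A\<close> in the fibre of \<open>T\<close> over \<open>(x, f x)\<close>, so it suffices to find a continuous section of
  \<open>T\<close> over \<open>T ` A\<close> with values in \<open>A\<close>. The section used here picks the point of least norm in
  each (compact convex) fibre.

  Being a \<open>P\<close>-set says that \<open>A\<close> projects openly along every single direction. This alone makes
  every linear map \<open>T\<close> open from \<open>A\<close> onto \<open>T ` A\<close>, whatever the dimension of its kernel:
  suppose points \<open>s k\<close> of \<open>A\<close> converge to \<open>u\<close>, and let \<open>z\<close> be another point of the fibre of
  \<open>u\<close>. Then \<open>z - u\<close> is one direction in the kernel, and moving each \<open>s k\<close> along that direction
  inside \<open>A\<close>, which does not change \<open>T (s k)\<close>, gives points converging to \<open>z\<close>
  (\<open>P_set_shift_sequence\<close>).

  With \<open>z\<close> the least-norm point of the limit fibre and \<open>s k\<close> the least-norm points of the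
  neighbouring fibres, comparing norms in the limit shows that \<open>u\<close> is no longer than \<open>z\<close>, hence
  equal to it. So the least-norm section has a closed graph, and since its values lie in the
  compact set \<open>A\<close> it is continuous (\<open>P_set_least_norm_section\<close>).
\<close>

section \<open>Moving inside a set along one direction\<close>

lemma orth_proj_add_inner: "orth_proj q z + (q \<bullet> z) *\<^sub>R q = z"
  by (simp add: orth_proj_def)

text \<open>A minimum exists because a line meets a compact set in a compact set.\<close>

lemma lower_fun_attained:
  fixes A :: "'a::euclidean_space set"
  assumes "compact A" and "norm q = 1" and z: "z \<in> A"
  shows "orth_proj q z + lower_fun A q (orth_proj q z) *\<^sub>R q \<in> A"
    and "lower_fun A q (orth_proj q z) \<le> q \<bullet> z"
proof -
  let ?x = "orth_proj q z"
  let ?M = "{\<mu>. ?x + \<mu> *\<^sub>R q \<in> A}"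
  have qq: "q \<bullet> q = 1"
    using \<open>norm q = 1\<close> by (simp add: dot_square_norm)
  have "q \<bullet> ?x = 0"
    by (simp add: orth_proj_def inner_diff_right qq)
  then have "\<mu> = q \<bullet> (?x + \<mu> *\<^sub>R q)" for \<mu>
    by (simp add: inner_add_right qq)
  then have "?M \<subseteq> (\<lambda>y. q \<bullet> y) ` A"
    by (metis (mono_tags, lifting) image_eqI mem_Collect_eq subsetI)
  moreover have "compact ((\<lambda>y. q \<bullet> y) ` A)"
    using \<open>compact A\<close> by (intro compact_continuous_image continuous_intros)
  ultimately have "bounded ?M"
    using bounded_subset compact_imp_bounded by blast
  moreover have "closed ?M"
  proof -
    have "closed ((\<lambda>\<mu>. ?x + \<mu> *\<^sub>R q) -` A)"
      using compact_imp_closed[OF \<open>compact A\<close>]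
      by (intro continuous_closed_vimage) (auto intro!: continuous_intros)
    then show ?thesis
      by (simp add: vimage_def)
  qed
  ultimately have "compact ?M"
    by (simp add: compact_eq_bounded_closed)
  moreover have mem: "q \<bullet> z \<in> ?M"
    using z by (simp add: orth_proj_add_inner)
  ultimately obtain m where m: "m \<in> ?M" "\<forall>t\<in>?M. m \<le> t"
    using compact_attains_inf[of ?M] by blast
  then have "lower_fun A q ?x = m"
    unfolding lower_fun_def by (intro Least_equality) auto
  with m mem show "?x + lower_fun A q ?x *\<^sub>R q \<in> A" and "lower_fun A q ?x \<le> q \<bullet> z"
    by auto
qed

text \<open>
  Measure heights along the unit vector \<open>q\<close> pointing from \<open>z\<close> to \<open>u\<close>. On the line through
  \<open>s k\<close> in direction \<open>q\<close>, the set contains all points between the lowest one and \<open>s k\<close>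
  itself. Clamping the height of \<open>z\<close> to this segment gives the new point. The ends of the segment
  converge, by continuity of \<open>lower_fun\<close>, to the ends of a segment through \<open>z\<close>, so the
  clamping disappears in the limit.
\<close>

lemma P_set_shift_sequence:
  fixes A :: "'a::euclidean_space set"
  assumes "P_set A" and z: "z \<in> A" and u: "u \<in> A"
    and s: "\<And>k::nat. s k \<in> A" and lim: "s \<longlonglongrightarrow> u"
  obtains r where "\<And>k. r k \<in> A" "r \<longlonglongrightarrow> z" "\<And>k. \<exists>t. r k = s k + t *\<^sub>R (z - u)"
proof (cases "z = u")
  case True
  show thesis
  proof (rule that[of s])
    show "\<exists>t. s k = s k + t *\<^sub>R (z - u)" for k
      by (rule exI[of _ 0]) simp
  qed (use s lim True in auto)
next
  case False
  define q where "q = (u - z) /\<^sub>R norm (u - z)"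
  have nq: "norm q = 1"
    using False by (simp add: q_def)
  have uz: "u - z = norm (u - z) *\<^sub>R q"
    using False by (simp add: q_def)
  have qq: "q \<bullet> q = 1"
    using nq by (simp add: dot_square_norm)
  have conv: "convex A" and comp: "compact A"
    and cont: "continuous_on (orth_proj q ` A) (lower_fun A q)"
    using \<open>P_set A\<close> nq by (auto simp: P_set_def)
  have "q \<bullet> (u - z) = norm (u - z)"
    by (subst uz) (simp add: qq)
  then have height: "q \<bullet> u = q \<bullet> z + norm (u - z)"
    by (simp add: inner_diff_right)
  then have "orth_proj q u = u - norm (u - z) *\<^sub>R q - (q \<bullet> z) *\<^sub>R q"
    by (simp add: orth_proj_def scaleR_add_left)
  also have "\<dots> = orth_proj q z"
    unfolding uz[symmetric] by (simp add: orth_proj_def)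
  finally have same_line: "orth_proj q u = orth_proj q z" .
  define m where "m k = lower_fun A q (orth_proj q (s k))" for k
  define t where "t k = min (q \<bullet> s k) (max (m k) (q \<bullet> z))" for k
  define r where "r k = orth_proj q (s k) + t k *\<^sub>R q" for k
  have proj_lim: "(\<lambda>k. orth_proj q (s k)) \<longlonglongrightarrow> orth_proj q z"
    unfolding same_line[symmetric] unfolding orth_proj_def
    by (intro tendsto_intros lim)
  have m_lim: "m \<longlonglongrightarrow> lower_fun A q (orth_proj q z)"
    unfolding m_def
    by (rule continuous_on_tendsto_compose[OF cont proj_lim]) (use z s in auto)
  have "t \<longlonglongrightarrow> min (q \<bullet> u) (max (lower_fun A q (orth_proj q z)) (q \<bullet> z))"
    unfolding t_def by (intro tendsto_intros lim m_lim)
  moreover have "min (q \<bullet> u) (max (lower_fun A q (orth_proj q z)) (q \<bullet> z)) = q \<bullet> z"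
    using lower_fun_attained(2)[OF comp nq z] height by simp
  ultimately have "t \<longlonglongrightarrow> q \<bullet> z"
    by simp
  then have "r \<longlonglongrightarrow> orth_proj q z + (q \<bullet> z) *\<^sub>R q"
    unfolding r_def by (intro tendsto_intros proj_lim)
  then have r_lim: "r \<longlonglongrightarrow> z"
    by (simp add: orth_proj_add_inner)
  have r_mem: "r k \<in> A" for k
  proof -
    let ?x = "orth_proj q (s k)"
    have low: "?x + m k *\<^sub>R q \<in> A" and le: "m k \<le> q \<bullet> s k"
      using lower_fun_attained[OF comp nq s[of k]] by (auto simp: m_def)
    have high: "?x + (q \<bullet> s k) *\<^sub>R q \<in> A"
      using s[of k] by (simp add: orth_proj_add_inner)
    have "t k \<in> closed_segment (m k) (q \<bullet> s k)"
      using le by (auto simp: t_def closed_segment_eq_real_ivl)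
    then obtain c where c: "0 \<le> c" "c \<le> 1" "t k = (1 - c) * m k + c * (q \<bullet> s k)"
      by (auto simp: in_segment)
    have "r k = (1 - c) *\<^sub>R (?x + m k *\<^sub>R q) + c *\<^sub>R (?x + (q \<bullet> s k) *\<^sub>R q)"
      by (simp add: r_def c(3) algebra_simps)
    then show ?thesis
      using convexD_alt[OF conv low high c(1,2)] by simp
  qed
  have "\<exists>c. r k = s k + c *\<^sub>R (z - u)" for k
  proof
    let ?c = "q \<bullet> s k - t k"
    have "z - u = - (norm (u - z) *\<^sub>R q)"
      using uz by (metis minus_diff_eq)
    then have "(?c / norm (u - z)) *\<^sub>R (z - u) = - (?c *\<^sub>R q)"
      using False by simp
    then show "r k = s k + (?c / norm (u - z)) *\<^sub>R (z - u)"
      by (simp add: r_def orth_proj_def scaleR_diff_left)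
  qed
  with r_mem r_lim show thesis
    by (rule that)
qed

section \<open>Continuous sections of linear maps on \<open>P\<close>-sets\<close>

text \<open>
  Strict convexity of the Euclidean norm makes the least-norm point of a fibre unique; this is what
  turns the comparison of norms into an identification of the limit.
\<close>

lemma P_set_least_norm_section:
  fixes A :: "'a::euclidean_space set" and T :: "'a \<Rightarrow> 'b::euclidean_space"
  assumes P: "P_set A" and T: "linear T"
  obtains g where "continuous_on (T ` A) g" "\<And>w. w \<in> T ` A \<Longrightarrow> g w \<in> A \<and> T (g w) = w"
proof -
  have conv: "convex A" and comp: "compact A"
    using P by (auto simp: P_set_def)
  have T_cont: "continuous_on X T" for X
    using T by (rule linear_continuous_on[OF linear_conv_bounded_linear[THEN iffD1]])
  define fibre where "fibre w = A \<inter> T -` {w}" for w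
  have closed_fibre: "closed (fibre w)" for w
    unfolding fibre_def
    by (intro closed_Int compact_imp_closed comp continuous_closed_vimage)
       (use T_cont in \<open>auto simp: continuous_on_eq_continuous_within\<close>)
  have convex_fibre: "convex (fibre w)" for w
    unfolding fibre_def
    by (intro convex_Int conv convex_linear_vimage T) auto
  define g where "g w = closest_point (fibre w) 0" for w
  have g_fibre: "g w \<in> fibre w" if "w \<in> T ` A" for w
    unfolding g_def using that
    by (intro closest_point_in_set closed_fibre) (auto simp: fibre_def)
  have g_least: "norm (g w) \<le> norm y" if "y \<in> fibre w" for w y
    using closest_point_le[OF closed_fibre that, of 0] by (simp add: g_def)
  have g_mem: "g w \<in> A \<and> T (g w) = w" if "w \<in> T ` A" for w
    using g_fibre[OF that] by (simp add: fibre_def)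
  have "closed ((\<lambda>w. (w, g w)) ` (T ` A))"
    unfolding closed_sequential_limits
  proof (intro allI impI, elim conjE)
    fix p :: "nat \<Rightarrow> 'b \<times> 'a" and l
    assume p: "\<forall>k. p k \<in> (\<lambda>w. (w, g w)) ` (T ` A)" and pl: "p \<longlonglongrightarrow> l"
    obtain w u where l: "l = (w, u)"
      by (cases l)
    define v where "v k = fst (p k)" for k
    define s where "s k = snd (p k)" for k
    have v: "v k \<in> T ` A" and sv: "s k = g (v k)" for k
      using p by (auto simp: v_def s_def image_iff dest!: spec[of _ k])
    have v_lim: "v \<longlonglongrightarrow> w" and s_lim: "s \<longlonglongrightarrow> u"
      using tendsto_fst[OF pl] tendsto_snd[OF pl] by (simp_all add: l v_def[abs_def] s_def[abs_def])
    have s_mem: "s k \<in> A" and Ts: "T (s k) = v k" for k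
      using g_mem[OF v] by (auto simp: sv)
    have u_mem: "u \<in> A"
      using compact_imp_closed[OF comp] s_mem s_lim by (auto simp: closed_sequential_limits)
    have "(\<lambda>k. T (s k)) \<longlonglongrightarrow> T u"
      by (rule continuous_on_tendsto_compose[OF T_cont[of UNIV] s_lim]) auto
    then have Tu: "T u = w"
      using v_lim LIMSEQ_unique by (simp add: Ts) blast
    then have w: "w \<in> T ` A"
      using u_mem by blast
    have z: "g w \<in> A" "T (g w) = w"
      using g_mem[OF w] by auto
    obtain r where r: "\<And>k. r k \<in> A" "r \<longlonglongrightarrow> g w"
        and shift: "\<And>k. \<exists>t. r k = s k + t *\<^sub>R (g w - u)"
      using P_set_shift_sequence[OF P z(1) u_mem s_mem s_lim] by blast
    have "T (r k) = v k" for k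
      using shift[of k] T by (auto simp: linear_add linear_scale linear_diff z Tu Ts)
    then have "norm (s k) \<le> norm (r k)" for k
      using g_least[of "r k" "v k"] r(1) by (simp add: fibre_def sv)
    then have "norm u \<le> norm (g w)"
      by (intro LIMSEQ_le[OF tendsto_norm[OF s_lim] tendsto_norm[OF r(2)]]) auto
    then have "\<forall>y\<in>fibre w. dist 0 u \<le> dist 0 y"
      using g_least by (auto intro: order_trans)
    then have "u = g w"
      unfolding g_def
      by (intro closest_point_unique convex_fibre closed_fibre)
         (use u_mem Tu in \<open>auto simp: fibre_def\<close>)
    then show "l \<in> (\<lambda>w. (w, g w)) ` (T ` A)"
      using w by (simp add: l)
  qed
  then have "closedin (top_of_set (T ` A \<times> A)) ((\<lambda>w. (w, g w)) ` (T ` A))"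
    by (rule closed_subset[rotated]) (use g_mem in auto)
  then have "continuous_on (T ` A) g"
    using continuous_closed_graph_eq[OF comp, of g "T ` A"] g_mem by auto
  then show thesis
    using g_mem by (rule that)
qed

section \<open>Splitting a selection\<close>

theorem theorem2p7:
  fixes F1 :: "real ^ 'n \<Rightarrow> (real ^ 'm1) set"
    and F2 :: "real ^ 'n \<Rightarrow> (real ^ 'm2) set"
    and L :: "(real ^ 'm1) \<times> (real ^ 'm2) \<Rightarrow> real ^ 'k"
    and f :: "real ^ 'n \<Rightarrow> real ^ 'k"
  assumes "P_set (pair_graph F1 F2)"
    and "linear L" and "surj L"
    and "continuous_selection (pair_dom F1 F2)
           (\<lambda>x. {L (y1, y2) | y1 y2. y1 \<in> F1 x \<and> y2 \<in> F2 x}) f"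
  shows "\<exists>f1 f2. continuous_selection (pair_dom F1 F2) F1 f1 \<and>
                 continuous_selection (pair_dom F1 F2) F2 f2 \<and>
                 (\<forall>x\<in>pair_dom F1 F2. f x = L (f1 x, f2 x))"
proof -
  let ?A = "pair_graph F1 F2" and ?D = "pair_dom F1 F2"
  define T where "T p = (fst p, L (snd p))" for p :: "(real ^ 'n) \<times> (real ^ 'm1) \<times> (real ^ 'm2)"
  have "linear T"
    using \<open>linear L\<close> by (intro linearI) (simp_all add: T_def linear_add linear_scale)
  then obtain g where g_cont: "continuous_on (T ` ?A) g"
      and g: "\<And>w. w \<in> T ` ?A \<Longrightarrow> g w \<in> ?A \<and> T (g w) = w"
    using P_set_least_norm_section[OF assms(1)] by blast
  have f_cont: "continuous_on ?D f"
    and f_sel: "\<And>x. x \<in> ?D \<Longrightarrow> \<exists>y1 y2. f x = L (y1, y2) \<and> y1 \<in> F1 x \<and> y2 \<in> F2 x"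
    using assms(4) by (auto simp: continuous_selection_def)
  have lift: "(x, f x) \<in> T ` ?A" if x: "x \<in> ?D" for x
  proof -
    obtain y1 y2 where y: "f x = L (y1, y2)" "y1 \<in> F1 x" "y2 \<in> F2 x"
      using f_sel[OF x] by blast
    show ?thesis
      by (rule image_eqI[of _ _ "(x, y1, y2)"]) (use y in \<open>auto simp: T_def pair_graph_def\<close>)
  qed
  define h where "h x = snd (g (x, f x))" for x
  have h: "fst (h x) \<in> F1 x \<and> snd (h x) \<in> F2 x \<and> f x = L (h x)" if "x \<in> ?D" for x
    using g[OF lift[OF that]]
    by (cases "g (x, f x)") (auto simp: h_def T_def pair_graph_def)
  have "continuous_on ?D (\<lambda>x. g (x, f x))"
    by (rule continuous_on_compose2[OF g_cont]) (use lift in \<open>auto intro!: continuous_intros f_cont\<close>)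
  then have "continuous_on ?D h"
    unfolding h_def by (rule continuous_on_snd)
  then have "continuous_selection ?D F1 (fst \<circ> h)" and "continuous_selection ?D F2 (snd \<circ> h)"
    using h by (auto simp: continuous_selection_def o_def intro: continuous_intros)
  moreover have "\<forall>x\<in>?D. f x = L ((fst \<circ> h) x, (snd \<circ> h) x)"
    using h by simp
  ultimately show ?thesis
    by blast
qed

end
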